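(* Let $F$ be either the graph $2P_3$ or the claw $K_{1,3}$. Then no minimally nonperfectly divisible $F$-free graph contains a clique cutset.
   Context: Graphs are finite and simple. $2P_3$ is the disjoint union of two paths on $3$ vertices; the claw is $K_{1,3}$. $G$ is $F$-free if no induced subgraph of $G$ is isomorphic to $F$. A clique cutset of a connected graph $G$ is a clique $X$ such that $G-X$ is disconnected. A perfect division of $G$ is a partition $(A,B)$ of $V(G)$ such that $G[A]$ is perfect and $\omega(G[B])<\omega(G)$. $G$ is perfectly divisible if every nonempty induced subgraph has a perfect division; $G$ is minimally nonperfectly divisible if $G$ is not perfectly divisible but every proper induced subgraph is. *)

theory Defs
  imports "Graph_Theory.Graph_Theory"
begin

text \<open>
  A finite simple graph is a \<^locale>\<open>graph\<close> of the library: a finite symmetric digraph without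
  loops and parallel arcs. An undirected edge is a pair of opposite arcs.
\<close>

definition two_P3 :: "nat pair_pre_digraph" where
  "two_P3 = \<lparr> pverts = {0,1,2,3,4,5}, parcs = {(0,1), (1,2), (3,4), (4,5)}\<^sup>s \<rparr>"

definition claw :: "nat pair_pre_digraph" where
  "claw = \<lparr> pverts = {0,1,2,3}, parcs = {(0,1), (0,2), (0,3)}\<^sup>s \<rparr>"

lemma graph_two_P3: "graph (with_proj two_P3)"
proof -
  interpret pair_graph two_P3
    by unfold_locales (auto simp: two_P3_def symcl_def symmetric_def intro!: symI)
  show ?thesis by unfold_locales
qed

lemma claw_is_K13: "K\<^bsub>1,3\<^esub> (with_proj claw)"
  unfolding complete_bipartite_digraph_pair_def
proof (intro conjI exI)
  show "pverts claw = {0} \<union> {1,2,3}" by (auto simp: claw_def)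
  show "parcs claw = {0} \<times> {1,2,3} \<union> {1,2,3} \<times> {0}" by (auto simp: claw_def symcl_def)
qed (simp_all add: claw_def)

definition induced_free :: "('c,'d) pre_digraph \<Rightarrow> ('a,'b) pre_digraph \<Rightarrow> bool" where
  "induced_free F G \<longleftrightarrow> \<not> (\<exists>H. induced_subgraph H G \<and> digraph_iso H F)"

definition clique :: "('a,'b) pre_digraph \<Rightarrow> 'a set \<Rightarrow> bool" where
  "clique G X \<longleftrightarrow> X \<subseteq> verts G \<and> (\<forall>u\<in>X. \<forall>v\<in>X. u \<noteq> v \<longrightarrow> u \<rightarrow>\<^bsub>G\<^esub> v)"

text \<open>The empty set is a clique, so the null graph has clique number 0.\<close>

definition clique_number :: "('a,'b) pre_digraph \<Rightarrow> nat" where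
  "clique_number G = Max (card ` {X. clique G X})"

definition proper_colouring :: "('a,'b) pre_digraph \<Rightarrow> nat \<Rightarrow> ('a \<Rightarrow> nat) \<Rightarrow> bool" where
  "proper_colouring G k c \<longleftrightarrow>
     c ` verts G \<subseteq> {..<k} \<and> (\<forall>u v. u \<rightarrow>\<^bsub>G\<^esub> v \<longrightarrow> c u \<noteq> c v)"

definition chromatic_number :: "('a,'b) pre_digraph \<Rightarrow> nat" where
  "chromatic_number G = (LEAST k. \<exists>c. proper_colouring G k c)"

definition perfect_graph :: "('a,'b) pre_digraph \<Rightarrow> bool" where
  "perfect_graph G \<longleftrightarrow> (\<forall>H. induced_subgraph H G \<longrightarrow> chromatic_number H = clique_number H)"

text \<open>
  The library's \<^const>\<open>Digraph_Component.connected\<close> is false for the null graph. The null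
  graph must not count as disconnected, as otherwise the whole vertex set of a complete graph
  would be a clique cutset.
\<close>

definition disconnected :: "('a,'b) pre_digraph \<Rightarrow> bool" where
  "disconnected G \<longleftrightarrow> verts G \<noteq> {} \<and> \<not> Digraph_Component.connected G"

definition clique_cutset :: "('a,'b) pre_digraph \<Rightarrow> 'a set \<Rightarrow> bool" where
  "clique_cutset G X \<longleftrightarrow>
     Digraph_Component.connected G \<and> clique G X \<and> disconnected (G \<restriction> (verts G - X))"

text \<open>Either part of a perfect division may be empty.\<close>

definition perfect_division :: "('a,'b) pre_digraph \<Rightarrow> 'a set \<Rightarrow> 'a set \<Rightarrow> bool" where
  "perfect_division G A B \<longleftrightarrow>
     A \<union> B = verts G \<and> A \<inter> B = {} \<and>
     perfect_graph (G \<restriction> A) \<and> clique_number (G \<restriction> B) < clique_number G"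

definition perfectly_divisible :: "('a,'b) pre_digraph \<Rightarrow> bool" where
  "perfectly_divisible G \<longleftrightarrow>
     (\<forall>H. induced_subgraph H G \<and> verts H \<noteq> {} \<longrightarrow> (\<exists>A B. perfect_division H A B))"

definition minimally_nonperfectly_divisible :: "('a,'b) pre_digraph \<Rightarrow> bool" where
  "minimally_nonperfectly_divisible G \<longleftrightarrow>
     \<not> perfectly_divisible G \<and>
     (\<forall>H. induced_subgraph H G \<and> H \<noteq> G \<longrightarrow> perfectly_divisible H)"

end

theory Submission
  imports Defs
begin

text \<open>
  Let the clique \<open>X\<close> separate \<open>V1\<close> from \<open>V2\<close>. Perfect sets glue along cliques, and a set in a critical
  graph whose deletion lowers the clique number is never perfect. If \<open>V1\<close> is itself a clique, then
  \<open>V1 \<union> X\<close> is perfect (Koenig), and adding \<open>V1\<close> to the perfect part of a division of \<open>V2 \<union> X\<close>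
  divides the whole graph. In a \<open>2P\<^sub>3\<close>-free graph one side is \<open>P\<^sub>3\<close>-free, and its components are cliques.

  In a claw-free graph with every vertex of \<open>X\<close> having neighbours on both sides, the neighbourhoods
  \<open>N1 x\<close> and \<open>N2 x\<close> in the two sides are cliques, and \<open>N1 x \<subseteq> N1 y\<close> or \<open>N2 x \<subseteq> N2 y\<close> for all
  \<open>x, y \<in> X\<close>. If \<open>V2\<close> is as small as possible, then no \<open>N2 l\<close> is least, as otherwise
  \<open>X - {l} \<union> N2 l\<close> would be a clique cutset with a smaller side; hence some \<open>N1 g\<close> is greatest.
  A division of \<open>V1\<close> and a division of \<open>V2 \<union> X\<close> can then be merged.
\<close>

section \<open>Perfect vertex sets\<close>

text \<open>Induced subgraphs are represented by vertex sets of one fixed relation, so that deleting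
  and joining parts become set operations.\<close>

locale adjacency =
  fixes E :: "'a \<Rightarrow> 'a \<Rightarrow> bool"
  assumes adj_sym: "E u v \<Longrightarrow> E v u"
    and adj_irrefl: "\<not> E u u"
begin

definition is_clique :: "'a set \<Rightarrow> bool" where
  "is_clique Q \<longleftrightarrow> (\<forall>u\<in>Q. \<forall>v\<in>Q. u \<noteq> v \<longrightarrow> E u v)"

definition omega :: "'a set \<Rightarrow> nat" where
  "omega S = Max (card ` {Q. Q \<subseteq> S \<and> is_clique Q})"

definition colourable :: "'a set \<Rightarrow> nat \<Rightarrow> bool" where
  "colourable S k \<longleftrightarrow> (\<exists>c. c ` S \<subseteq> {..<k} \<and> (\<forall>u\<in>S. \<forall>v\<in>S. E u v \<longrightarrow> c u \<noteq> c v))"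

text \<open>The clique number is always a lower bound for the number of colours
  (\<open>omega_le_colours\<close>), so on finite sets this is equality of chromatic and clique
  number.\<close>

definition perfect_on :: "'a set \<Rightarrow> bool" where
  "perfect_on S \<longleftrightarrow> (\<forall>T\<subseteq>S. colourable T (omega T))"

definition divisible :: "'a set \<Rightarrow> bool" where
  "divisible S \<longleftrightarrow> (\<exists>A\<subseteq>S. perfect_on A \<and> omega (S - A) < omega S)"

text \<open>The empty set is left out because it is never divisible: its clique number 0 cannot
  drop.\<close>

definition critical :: "'a set \<Rightarrow> bool" where
  "critical V \<longleftrightarrow> \<not> divisible V \<and> (\<forall>S. S \<subset> V \<and> S \<noteq> {} \<longrightarrow> divisible S)"

text \<open>The sides are unions of components of \<open>V - X\<close>, not single components;
  components can thus be regrouped and the sides exchanged.\<close>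

definition separation :: "'a set \<Rightarrow> 'a set \<Rightarrow> 'a set \<Rightarrow> 'a set \<Rightarrow> bool" where
  "separation V X V1 V2 \<longleftrightarrow>
     V = V1 \<union> X \<union> V2 \<and> V1 \<inter> X = {} \<and> V1 \<inter> V2 = {} \<and> X \<inter> V2 = {} \<and>
     V1 \<noteq> {} \<and> V2 \<noteq> {} \<and> is_clique X \<and> (\<forall>u\<in>V1. \<forall>v\<in>V2. \<not> E u v)"

definition nbrs :: "'a set \<Rightarrow> 'a \<Rightarrow> 'a set" where
  "nbrs S v = {u\<in>S. E v u}"

lemma in_nbrs [simp]: "u \<in> nbrs S v \<longleftrightarrow> u \<in> S \<and> E v u"
  by (auto simp: nbrs_def)

section \<open>Cliques and the clique number\<close>

lemma clique_subset: "is_clique Q \<Longrightarrow> P \<subseteq> Q \<Longrightarrow> is_clique P"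
  by (auto simp: is_clique_def)

lemma clique_insert: "is_clique Q \<Longrightarrow> (\<And>u. u \<in> Q \<Longrightarrow> u \<noteq> v \<Longrightarrow> E v u) \<Longrightarrow> is_clique (insert v Q)"
  by (auto simp: is_clique_def adj_sym)

lemma clique_Un:
  "is_clique P \<Longrightarrow> is_clique Q \<Longrightarrow> (\<And>u v. u \<in> P \<Longrightarrow> v \<in> Q \<Longrightarrow> u \<noteq> v \<Longrightarrow> E u v) \<Longrightarrow> is_clique (P \<union> Q)"
  unfolding is_clique_def by (metis Un_iff adj_sym)

lemma clique_empty [simp]: "is_clique {}"
  by (simp add: is_clique_def)

lemma card_clique_le_omega: "finite S \<Longrightarrow> Q \<subseteq> S \<Longrightarrow> is_clique Q \<Longrightarrow> card Q \<le> omega S"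
  unfolding omega_def by (rule Max_ge) auto

lemma omega_clique:
  assumes "finite S"
  obtains Q where "Q \<subseteq> S" "is_clique Q" "card Q = omega S"
proof -
  have "omega S \<in> card ` {Q. Q \<subseteq> S \<and> is_clique Q}"
    unfolding omega_def using assms by (intro Max_in) (auto intro: exI[of _ "{}"])
  then show thesis using that by auto
qed

lemma omega_mono: "finite S \<Longrightarrow> T \<subseteq> S \<Longrightarrow> omega T \<le> omega S"
  by (metis card_clique_le_omega finite_subset omega_clique order_trans)

lemma omega_lessI:
  assumes "finite S" "\<And>Q. Q \<subseteq> S \<Longrightarrow> is_clique Q \<Longrightarrow> card Q \<noteq> n" "omega S \<le> n"
  shows "omega S < n"
  by (metis assms le_neq_implies_less omega_clique)

text \<open>Otherwise \<open>insert v Q\<close> would be a clique larger than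
  \<open>omega V\<close>.\<close>

lemma max_clique_absorbs:
  assumes "finite V" "Q \<subseteq> V" "is_clique Q" "card Q = omega V" "v \<in> V"
    "\<And>u. u \<in> Q \<Longrightarrow> u \<noteq> v \<Longrightarrow> E v u"
  shows "v \<in> Q"
proof (rule ccontr)
  assume "v \<notin> Q"
  moreover have "card (insert v Q) \<le> omega V"
    using assms by (intro card_clique_le_omega clique_insert) auto
  ultimately show False
    using assms finite_subset[of Q V] by simp
qed

section \<open>Colourings and gluing of perfect sets\<close>

lemma colourable_mono: "colourable S k \<Longrightarrow> k \<le> l \<Longrightarrow> colourable S l"
  unfolding colourable_def by (meson lessThan_subset_iff order_trans)

lemma omega_le_colours:
  assumes "finite S" "colourable S k"
  shows "omega S \<le> k"
proof -
  obtain Q where Q: "Q \<subseteq> S" "is_clique Q" "card Q = omega S"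
    using omega_clique[OF assms(1)] .
  obtain c where c: "c ` S \<subseteq> {..<k}" "\<forall>u\<in>S. \<forall>v\<in>S. E u v \<longrightarrow> c u \<noteq> c v"
    using assms(2) unfolding colourable_def by blast
  have "inj_on c Q"
    using Q c(2) unfolding is_clique_def inj_on_def by blast
  then have "card Q = card (c ` Q)" by (simp add: card_image)
  also have "\<dots> \<le> k"
    using c(1) Q(1) card_mono[of "{..<k}" "c ` Q"] by auto
  finally show ?thesis using Q by simp
qed

lemma perfect_on_subset: "perfect_on S \<Longrightarrow> T \<subseteq> S \<Longrightarrow> perfect_on T"
  by (auto simp: perfect_on_def)

text \<open>Colourings of the two parts are injective on the common clique, so the colours of one
  can be permuted until both agree there. No edge joins the two remainders.\<close>

lemma perfect_on_glue:
  assumes fin: "finite S1" "finite S2"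
    and perf: "perfect_on S1" "perfect_on S2"
    and cl: "is_clique (S1 \<inter> S2)"
    and sep: "\<And>u v. u \<in> S1 - S2 \<Longrightarrow> v \<in> S2 - S1 \<Longrightarrow> \<not> E u v"
  shows "perfect_on (S1 \<union> S2)"
  unfolding perfect_on_def
proof (intro allI impI)
  fix T assume T: "T \<subseteq> S1 \<union> S2"
  define k where "k = omega T"
  have finT: "finite T" using fin T finite_subset by blast
  have "colourable (T \<inter> S1) k" "colourable (T \<inter> S2) k"
    using perf finT unfolding perfect_on_def k_def
    by (meson Int_lower1 Int_lower2 colourable_mono omega_mono)+
  note col = this[unfolded colourable_def]
  obtain c1 where c1: "c1 ` (T \<inter> S1) \<subseteq> {..<k}"
      "\<And>u v. u \<in> T \<inter> S1 \<Longrightarrow> v \<in> T \<inter> S1 \<Longrightarrow> E u v \<Longrightarrow> c1 u \<noteq> c1 v"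
    using col(1) by metis
  obtain c2 where c2: "c2 ` (T \<inter> S2) \<subseteq> {..<k}"
      "\<And>u v. u \<in> T \<inter> S2 \<Longrightarrow> v \<in> T \<inter> S2 \<Longrightarrow> E u v \<Longrightarrow> c2 u \<noteq> c2 v"
    using col(2) by metis
  define K where "K = T \<inter> S1 \<inter> S2"
  have finK: "finite K" using finT by (simp add: K_def)
  have inj: "inj_on c1 K" "inj_on c2 K"
    using cl c1(2) c2(2) unfolding inj_on_def is_clique_def K_def by (metis Int_iff)+
  have sub: "c1 ` K \<subseteq> {..<k}" "c2 ` K \<subseteq> {..<k}"
    using c1(1) c2(1) by (auto simp: K_def)
  have "card ({..<k} - c2 ` K) = card ({..<k} - c1 ` K)"
    using inj sub finK by (simp add: card_Diff_subset card_image)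
  then obtain h where h: "bij_betw h ({..<k} - c2 ` K) ({..<k} - c1 ` K)"
    using finite_same_card_bij[of "{..<k} - c2 ` K" "{..<k} - c1 ` K"] by auto
  define p where "p i = (if i \<in> c2 ` K then c1 (the_inv_into K c2 i) else h i)" for i
  have pK: "p (c2 v) = c1 v" if "v \<in> K" for v
    using that inj(2) by (simp add: p_def the_inv_into_f_f)
  have p_range: "p i < k" if "i < k" for i
  proof (cases "i \<in> c2 ` K")
    case True
    then show ?thesis using pK sub(1) by auto
  next
    case False
    then show ?thesis using that h bij_betwE[OF h] by (auto simp: p_def)
  qed
  have p_inj: "inj_on p {..<k}"
  proof -
    have "inj_on p (c2 ` K \<union> ({..<k} - c2 ` K))"
    proof (subst inj_on_Un, intro conjI)
      show "inj_on p (c2 ` K)"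
        using inj(1) pK by (auto simp: inj_on_def)
      have "inj_on h ({..<k} - c2 ` K)" using h by (simp add: bij_betw_def)
      then show "inj_on p ({..<k} - c2 ` K)"
        by (rule inj_on_cong[THEN iffD1, rotated]) (auto simp: p_def)
      have "p ` ({..<k} - c2 ` K) \<subseteq> {..<k} - c1 ` K"
        using bij_betwE[OF h] by (auto simp: p_def)
      moreover have "p ` (c2 ` K) \<subseteq> c1 ` K" using pK by auto
      ultimately show "p ` (c2 ` K - ({..<k} - c2 ` K)) \<inter> p ` ({..<k} - c2 ` K - c2 ` K) = {}"
        by blast
    qed
    moreover have "c2 ` K \<union> ({..<k} - c2 ` K) = {..<k}" using sub(2) by blast
    ultimately show ?thesis by simp
  qed
  define c where "c v = (if v \<in> S1 then c1 v else p (c2 v))" for v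
  \<comment> \<open>After the permutation both colourings agree on \<open>K\<close>, so on all of
    \<open>T \<inter> S2\<close> the colouring is \<open>p\<close> after \<open>c2\<close>.\<close>
  have c_S2: "c v = p (c2 v)" if "v \<in> T \<inter> S2" for v
    using that pK by (auto simp: c_def K_def)
  have "c u \<noteq> c v" if uv: "u \<in> T" "v \<in> T" "E u v" for u v
  proof -
    consider "u \<in> S1" "v \<in> S1" | "u \<in> S2" "v \<in> S2"
      using uv T sep adj_sym by blast
    then show ?thesis
    proof cases
      case 1
      then show ?thesis using c1(2) uv by (auto simp: c_def)
    next
      case 2
      then have "c2 u \<noteq> c2 v" "c2 u < k" "c2 v < k" using c2 uv by auto
      then show ?thesis using 2 uv p_inj by (auto simp: c_S2 dest: inj_onD)
    qed
  qed
  moreover have "c ` T \<subseteq> {..<k}"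
  proof (intro subsetI, elim imageE)
    fix i v assume v: "i = c v" "v \<in> T"
    show "i \<in> {..<k}"
    proof (cases "v \<in> S1")
      case True
      then show ?thesis using v c1(1) by (auto simp: c_def)
    next
      case False
      then have "v \<in> T \<inter> S2" using v T by auto
      then show ?thesis using v c2(1) p_range[of "c2 v"] by (auto simp: c_S2)
    qed
  qed
  ultimately show "colourable T (omega T)"
    unfolding colourable_def k_def[symmetric] by blast
qed

text \<open>By induction \<open>T - I\<close> is coloured with as many colours as its clique number,
  and the stable set \<open>I\<close> takes one further colour, which the drop of
  \<open>omega\<close> pays for.\<close>

lemma perfect_on_if_stable_transversals:
  assumes "finite S"
    and "\<And>T. T \<subseteq> S \<Longrightarrow> T \<noteq> {} \<Longrightarrow>
      \<exists>I\<subseteq>T. (\<forall>u\<in>I. \<forall>v\<in>I. \<not> E u v) \<and> omega (T - I) < omega T"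
  shows "perfect_on S"
proof -
  have "colourable T (omega T)" if "T \<subseteq> S" for T
    using that
  proof (induction "card T" arbitrary: T rule: less_induct)
    case less
    have finT: "finite T" using less.prems assms(1) finite_subset by blast
    show ?case
    proof (cases "T = {}")
      case True
      then show ?thesis by (auto simp: colourable_def)
    next
      case False
      then obtain I where I: "I \<subseteq> T" "\<forall>u\<in>I. \<forall>v\<in>I. \<not> E u v" "omega (T - I) < omega T"
        using assms(2)[OF less.prems] by metis
      \<comment> \<open>An empty \<open>I\<close> would not lower \<open>omega\<close>; hence
        \<open>T - I\<close> is smaller than \<open>T\<close>.\<close>
      then have "I \<noteq> {}" by auto
      then have "card (T - I) < card T" using I(1) finT
        by (intro psubset_card_mono) auto
      then have "colourable (T - I) (omega (T - I))"
        using less by blast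
      then obtain c where c: "c ` (T - I) \<subseteq> {..<omega (T - I)}"
        "\<forall>u\<in>T - I. \<forall>v\<in>T - I. E u v \<longrightarrow> c u \<noteq> c v"
        unfolding colourable_def by blast
      \<comment> \<open>Colours start at 0, so \<open>omega (T - I)\<close> is the first colour that
        \<open>c\<close> leaves free on \<open>T - I\<close>.\<close>
      define d where "d v = (if v \<in> I then omega (T - I) else c v)" for v
      have "d ` T \<subseteq> {..<omega T}" using c(1) I(3) by (force simp: d_def)
      moreover have "d u \<noteq> d v" if uv: "u \<in> T" "v \<in> T" "E u v" for u v
      proof -
        have "c w \<noteq> omega (T - I)" if "w \<in> T - I" for w using c(1) that by auto
        then show ?thesis using uv c(2) I(2) by (cases "u \<in> I"; cases "v \<in> I") (force simp: d_def)+
      qed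
      ultimately show ?thesis unfolding colourable_def by blast
    qed
  qed
  then show ?thesis by (simp add: perfect_on_def)
qed

text \<open>
  Exchanging the two parts of maximum cliques gives maximum cliques again. So a maximum clique that
  meets \<open>K\<close> in as many vertices as possible has its \<open>L\<close>-part in every maximum clique.
\<close>

lemma maximum_clique_exchange:
  assumes fin: "finite T" and T: "T \<subseteq> K \<union> L" "K \<inter> L = {}" and cl: "is_clique K" "is_clique L"
    and P: "P \<subseteq> T" "is_clique P" "card P = omega T"
    and Q: "Q \<subseteq> T" "is_clique Q" "card Q = omega T"
    and max: "\<And>R. R \<subseteq> T \<Longrightarrow> is_clique R \<Longrightarrow> card R = omega T \<Longrightarrow> card (R \<inter> K) \<le> card (P \<inter> K)"
  shows "P \<inter> L \<subseteq> Q"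
proof -
  let ?R = "((P \<union> Q) \<inter> K) \<union> (P \<inter> Q \<inter> L)" and ?R' = "(P \<inter> Q \<inter> K) \<union> ((P \<union> Q) \<inter> L)"
  have finPQ: "finite P" "finite Q" using fin P Q finite_subset by blast+
  \<comment> \<open>A vertex of \<open>K\<close> and a vertex of \<open>L\<close> in the same one of
    these sets always lie together in \<open>P\<close> or together in \<open>Q\<close>.\<close>
  have "is_clique ?R" "is_clique ?R'"
    using P(2) Q(2) cl unfolding is_clique_def by blast+
  then have le: "card ?R \<le> omega T" "card ?R' \<le> omega T"
    using fin P(1) Q(1) by (auto intro!: card_clique_le_omega)
  have card_R: "card ?R = card ((P \<union> Q) \<inter> K) + card (P \<inter> Q \<inter> L)"
    and "card ?R' = card (P \<inter> Q \<inter> K) + card ((P \<union> Q) \<inter> L)"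
    using finPQ T(2) by (auto intro!: card_Un_disjoint)
  moreover have split: "card (A \<inter> K) + card (A \<inter> L) = card A" if "A \<subseteq> T" "finite A" for A
  proof -
    have "(A \<inter> K) \<union> (A \<inter> L) = A" "(A \<inter> K) \<inter> (A \<inter> L) = {}" using that T by blast+
    then show ?thesis using that card_Un_disjoint[of "A \<inter> K" "A \<inter> L"] by simp
  qed
  note split[of P] split[of Q]
  moreover have modular: "card ((P \<union> Q) \<inter> M) + card (P \<inter> Q \<inter> M) = card (P \<inter> M) + card (Q \<inter> M)" for M
  proof -
    have "(P \<inter> M) \<union> (Q \<inter> M) = (P \<union> Q) \<inter> M" "(P \<inter> M) \<inter> (Q \<inter> M) = P \<inter> Q \<inter> M" by blast+
    then show ?thesis using finPQ card_Un_Int[of "P \<inter> M" "Q \<inter> M"] by simp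
  qed
  note modular[of K] modular[of L]
  \<comment> \<open>The two sizes add up to \<open>card P + card Q\<close>, which is twice
    \<open>omega T\<close>, and neither exceeds \<open>omega T\<close>.\<close>
  ultimately have R: "card ?R = omega T"
    using le P Q finPQ by linarith
  have "card (?R \<inter> K) \<le> card (P \<inter> K)"
    by (rule max[OF _ \<open>is_clique ?R\<close> R]) (use P(1) Q(1) in blast)
  moreover have "?R \<inter> K = (P \<union> Q) \<inter> K" using T(2) by auto
  \<comment> \<open>\<open>?R\<close> is as large as \<open>P\<close> and has at most as many
    vertices in \<open>K\<close>, hence at least as many in \<open>L\<close>.\<close>
  ultimately have "card (P \<inter> L) \<le> card (P \<inter> Q \<inter> L)"
    using R card_R split[of P] P finPQ by simp
  then have "P \<inter> Q \<inter> L = P \<inter> L"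
    using finPQ by (intro card_seteq) auto
  then show ?thesis by blast
qed

text \<open>This is Koenig's theorem for complements of bipartite graphs. A stable set meeting all
  maximum cliques consists of one vertex, or of a vertex of one clique and a nonneighbour in the
  other.\<close>

lemma perfect_on_two_cliques:
  assumes fin: "finite K" "finite L" and cl: "is_clique K" "is_clique L" and disj: "K \<inter> L = {}"
  shows "perfect_on (K \<union> L)"
proof (rule perfect_on_if_stable_transversals)
  show "finite (K \<union> L)" using fin by simp
  fix T assume T: "T \<subseteq> K \<union> L" "T \<noteq> {}"
  \<comment> \<open>The situation is symmetric in \<open>K\<close> and \<open>L\<close>, and
    \<open>k\<close> may come from either.\<close>
  have *: "\<exists>I\<subseteq>T. (\<forall>u\<in>I. \<forall>v\<in>I. \<not> E u v) \<and> omega (T - I) < omega T"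
    if K: "finite K" "is_clique K" and L: "finite L" "is_clique L" and KL: "K \<inter> L = {}"
      and T: "T \<subseteq> K \<union> L" and k: "k \<in> T \<inter> K" for k K L
  proof (cases "omega (T - {k}) < omega T")
    case True
    then show ?thesis using k by (intro exI[of _ "{k}"]) (auto simp: adj_irrefl)
  next
    case False
    have finT: "finite T" using T K L finite_subset by blast
    let ?T = "T - {k}"
    \<comment> \<open>The maximum cliques of \<open>?T\<close> are therefore the maximum cliques of
      \<open>T\<close> that avoid \<open>k\<close>.\<close>
    have eq: "omega ?T = omega T" using False omega_mono[OF finT, of ?T] by simp
    let ?max = "\<lambda>Q. Q \<subseteq> ?T \<and> is_clique Q \<and> card Q = omega ?T"
    obtain Q0 where "?max Q0" using omega_clique[of ?T] finT by auto
    moreover have "\<forall>Q. ?max Q \<longrightarrow> card (Q \<inter> K) < Suc (card K)"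
      using K by (auto simp: less_Suc_eq_le card_mono)
    ultimately obtain P where P: "?max P" "\<And>R. ?max R \<Longrightarrow> card (R \<inter> K) \<le> card (P \<inter> K)"
      using ex_has_greatest_nat[of ?max Q0 "\<lambda>Q. card (Q \<inter> K)" "Suc (card K)"] by blast
    have "k \<notin> P" using P by auto
    \<comment> \<open>\<open>P\<close> is a maximum clique of \<open>T\<close>, so \<open>k\<close>
      outside \<open>P\<close> cannot be adjacent to all of it.\<close>
    then obtain u where u: "u \<in> P" "u \<noteq> k" "\<not> E k u"
      using max_clique_absorbs[OF finT, of P k] P eq k by auto
    have "u \<notin> K" using K(2) k u by (auto simp: is_clique_def)
    then have "u \<in> P \<inter> L" using u(1) P(1) T by auto
    \<comment> \<open>By the exchange, \<open>u\<close> lies in every maximum clique of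
      \<open>T\<close> that \<open>k\<close> misses.\<close>
    have hit: "u \<in> R" if "?max R" for R
    proof -
      have "P \<inter> L \<subseteq> R"
        by (rule maximum_clique_exchange[of ?T K L P R]) (use finT K L KL T P that in auto)
      then show ?thesis using \<open>u \<in> P \<inter> L\<close> by auto
    qed
    have "omega (T - {k, u}) < omega T"
    proof (rule omega_lessI)
      show "finite (T - {k, u})" using finT by simp
      show "omega (T - {k, u}) \<le> omega T" using finT by (intro omega_mono) auto
      fix Q assume "Q \<subseteq> T - {k, u}" "is_clique Q"
      then show "card Q \<noteq> omega T" using hit[of Q] eq by auto
    qed
    moreover have "{k, u} \<subseteq> T" using u P k by auto
    moreover have "\<forall>a\<in>{k, u}. \<forall>b\<in>{k, u}. \<not> E a b"
      using u adj_sym adj_irrefl by blast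
    ultimately show ?thesis by blast
  qed
  obtain k where "k \<in> T" using T by auto
  then consider "k \<in> T \<inter> K" | "k \<in> T \<inter> L" using T by auto
  then show "\<exists>I\<subseteq>T. (\<forall>u\<in>I. \<forall>v\<in>I. \<not> E u v) \<and> omega (T - I) < omega T"
  proof cases
    case 1
    then show ?thesis using *[OF fin(1) cl(1) fin(2) cl(2) disj T(1)] by simp
  next
    case 2
    have "L \<inter> K = {}" "T \<subseteq> L \<union> K" using disj T(1) by auto
    then show ?thesis using *[OF fin(2) cl(2) fin(1) cl(1) _ _ 2] by simp
  qed
qed

section \<open>Extending perfect sets by vertices with clique neighbourhoods\<close>

lemma perfect_on_clique: "finite K \<Longrightarrow> is_clique K \<Longrightarrow> perfect_on K"
  using perfect_on_two_cliques[of K "{}"] by simp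

text \<open>\<open>v\<close> and its neighbours in \<open>S\<close> form a clique, which is glued to
  \<open>S\<close> along the neighbours.\<close>

lemma perfect_on_insert_simplicial:
  assumes "finite S" "perfect_on S" "is_clique (nbrs S v)"
  shows "perfect_on (insert v S)"
proof (cases "v \<in> S")
  case True
  then show ?thesis using assms by (simp add: insert_absorb)
next
  case False
  have "is_clique (insert v (nbrs S v))"
    using assms(3) by (rule clique_insert) auto
  then have "perfect_on (S \<union> insert v (nbrs S v))"
  proof (intro perfect_on_glue)
    show "perfect_on (insert v (nbrs S v))"
      using \<open>is_clique (insert v (nbrs S v))\<close> assms(1) by (intro perfect_on_clique) (auto simp: nbrs_def)
    have "S \<inter> insert v (nbrs S v) = nbrs S v" using False by auto
    then show "is_clique (S \<inter> insert v (nbrs S v))" using assms(3) by simp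
    show "\<not> E u w" if "u \<in> S - insert v (nbrs S v)" "w \<in> insert v (nbrs S v) - S" for u w
      using that adj_sym[of u w] by auto
  qed (use assms in \<open>auto simp: nbrs_def\<close>)
  then show ?thesis by (rule perfect_on_subset) auto
qed

text \<open>A vertex \<open>p\<close> with least neighbourhood in \<open>S\<close> can be added
  last: its neighbours in \<open>S\<close> are also adjacent to the rest of \<open>P\<close>, so all
  its neighbours form a clique.\<close>

lemma perfect_on_Un_chain:
  assumes "finite S" "perfect_on S" "finite P" "is_clique P"
    and "\<And>p. p \<in> P \<Longrightarrow> is_clique (nbrs S p)"
    and "\<And>p q. p \<in> P \<Longrightarrow> q \<in> P \<Longrightarrow> nbrs S p \<subseteq> nbrs S q \<or> nbrs S q \<subseteq> nbrs S p"
  shows "perfect_on (S \<union> P)"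
  using assms(3-6)
proof (induction "card P" arbitrary: P rule: less_induct)
  case less
  show ?case
  proof (cases "P = {}")
    case True
    then show ?thesis using assms by simp
  next
    case False
    then obtain p where p: "p \<in> P" "\<And>q. q \<in> P \<Longrightarrow> card (nbrs S p) \<le> card (nbrs S q)"
      using ex_has_least_nat[of "\<lambda>p. p \<in> P" _ "\<lambda>p. card (nbrs S p)"] by blast
    \<comment> \<open>In a chain of finite sets, least cardinality means least by inclusion.\<close>
    have least: "nbrs S p \<subseteq> nbrs S q" if "q \<in> P" for q
    proof -
      have "nbrs S q = nbrs S p" if "nbrs S q \<subseteq> nbrs S p"
        using p(2)[OF \<open>q \<in> P\<close>] that assms(1)
        by (intro card_seteq) (auto simp: nbrs_def)
      then show ?thesis using less.prems(4)[OF p(1) \<open>q \<in> P\<close>] by blast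
    qed
    have "perfect_on (S \<union> (P - {p}))"
    proof (rule less.hyps)
      show "card (P - {p}) < card P" using p less.prems(1) by (intro card_Diff1_less) auto
      show "is_clique (P - {p})" using less.prems(2) by (rule clique_subset) auto
    qed (use less.prems in auto)
    moreover have "is_clique (nbrs (S \<union> (P - {p})) p)"
    proof -
      have "is_clique (nbrs S p \<union> (P - {p}))"
      proof (rule clique_Un)
        show "is_clique (P - {p})" using less.prems(2) by (rule clique_subset) auto
        show "E u v" if "u \<in> nbrs S p" "v \<in> P - {p}" for u v
          using that least[of v] adj_sym[of v u] by auto
      qed (use less.prems(3) p(1) in auto)
      then show ?thesis by (rule clique_subset) auto
    qed
    ultimately have "perfect_on (insert p (S \<union> (P - {p})))"
      using assms(1) less.prems(1) by (intro perfect_on_insert_simplicial) auto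
    moreover have "insert p (S \<union> (P - {p})) = S \<union> P" using p(1) by auto
    ultimately show ?thesis by simp
  qed
qed

section \<open>Clique separations of critical vertex sets\<close>

lemma separation_sym: "separation V X V1 V2 \<Longrightarrow> separation V X V2 V1"
proof -
  assume sep: "separation V X V1 V2"
  have "\<not> E u v" if "u \<in> V2" "v \<in> V1" for u v
    using sep that adj_sym[of u v] by (auto simp: separation_def)
  then show "separation V X V2 V1" using sep by (simp add: separation_def Un_ac Int_ac)
qed

lemma clique_across_separation:
  assumes "separation V X V1 V2" "is_clique Q" "Q \<subseteq> V"
  shows "Q \<subseteq> V1 \<union> X \<or> Q \<subseteq> V2 \<union> X"
proof (rule ccontr)
  have V: "V = V1 \<union> X \<union> V2" "V1 \<inter> V2 = {}" and no_edge: "\<And>u v. u \<in> V1 \<Longrightarrow> v \<in> V2 \<Longrightarrow> \<not> E u v"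
    using assms(1) by (auto simp: separation_def)
  assume "\<not> ?thesis"
  then obtain u v where uv: "u \<in> Q" "v \<in> Q" "u \<notin> V2 \<union> X" "v \<notin> V1 \<union> X" by blast
  then have "u \<in> V1" "v \<in> V2" using V assms(3) by auto
  moreover from this have "u \<noteq> v" using V by auto
  ultimately show False using uv(1,2) assms(2) no_edge[of u v] by (auto simp: is_clique_def)
qed

text \<open>The sets are glued along \<open>P\<close>, a clique because it lies in
  \<open>X\<close>.\<close>

lemma perfect_on_Un_separation:
  assumes "finite V" "separation V X V1 V2" "P \<subseteq> X" "B1 \<subseteq> V1" "B2 \<subseteq> V2"
    and "perfect_on (B1 \<union> P)" "perfect_on (B2 \<union> P)"
  shows "perfect_on (B1 \<union> B2 \<union> P)"
proof -
  have "perfect_on ((B1 \<union> P) \<union> (B2 \<union> P))"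
  proof (rule perfect_on_glue)
    show "finite (B1 \<union> P)" "finite (B2 \<union> P)"
      by (rule finite_subset[OF _ assms(1)]; use assms in \<open>auto simp: separation_def\<close>)+
    have "(B1 \<union> P) \<inter> (B2 \<union> P) = P" using assms by (auto simp: separation_def)
    then show "is_clique ((B1 \<union> P) \<inter> (B2 \<union> P))"
      using assms(2,3) clique_subset by (auto simp: separation_def)
    show "\<not> E u v" if "u \<in> B1 \<union> P - (B2 \<union> P)" "v \<in> B2 \<union> P - (B1 \<union> P)" for u v
    proof -
      have "u \<in> V1" "v \<in> V2" using that assms(4,5) by auto
      then show ?thesis using assms(2) by (auto simp: separation_def)
    qed
  qed (use assms in auto)
  moreover have "(B1 \<union> P) \<union> (B2 \<union> P) = B1 \<union> B2 \<union> P" by auto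
  ultimately show ?thesis by simp
qed

text \<open>Deleting a perfect set does not lower the clique number of an indivisible
  \<open>V\<close>. In \<open>separation_clique_side\<close> and
  \<open>separation_greatest_not_critical\<close> the contradiction comes from such a
  clique.\<close>

lemma not_divisible_clique:
  assumes "finite V" "\<not> divisible V" "A \<subseteq> V" "perfect_on A"
  obtains Q where "Q \<subseteq> V - A" "is_clique Q" "card Q = omega V"
proof -
  have "omega V \<le> omega (V - A)" using assms by (auto simp: divisible_def)
  moreover have "omega (V - A) \<le> omega V" using assms(1) by (intro omega_mono) auto
  ultimately show thesis
    using omega_clique[of "V - A"] assms(1) that by (metis finite_Diff le_antisym)
qed

text \<open>\<open>A\<close> is the perfect part of a division of \<open>S\<close>. A clique of size
  \<open>omega V\<close> in \<open>S\<close> is maximum there and cannot avoid \<open>A\<close>; if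
  \<open>S\<close> contains none, the last claim is void.\<close>

lemma critical_part_divides:
  assumes "finite V" "critical V" "S \<subset> V" "S \<noteq> {}"
  obtains A where "A \<subseteq> S" "perfect_on A"
    "\<And>Q. Q \<subseteq> S \<Longrightarrow> is_clique Q \<Longrightarrow> card Q = omega V \<Longrightarrow> Q \<inter> A \<noteq> {}"
proof -
  obtain A where A: "A \<subseteq> S" "perfect_on A" "omega (S - A) < omega S"
    using assms unfolding critical_def divisible_def by blast
  have fin: "finite S" using assms finite_subset by blast
  have "Q \<inter> A \<noteq> {}" if "Q \<subseteq> S" "is_clique Q" "card Q = omega V" for Q
  proof
    assume "Q \<inter> A = {}"
    then have "card Q \<le> omega (S - A)"
      using that fin by (intro card_clique_le_omega) auto
    then show False using A(3) that(3) omega_mono[OF assms(1), of S] assms(3) by auto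
  qed
  then show thesis using that A by blast
qed

text \<open>All of \<open>V1\<close> can join the perfect part, since \<open>V1 \<union> X\<close>
  is a union of two cliques. A maximum clique that avoids the enlarged part lies in
  \<open>V2 \<union> X\<close>, where \<open>A\<close> meets it.\<close>

lemma separation_clique_side:
  assumes fin: "finite V" and sep: "separation V X V1 V2" and cl: "is_clique V1"
  shows "\<not> critical V"
proof
  assume crit: "critical V"
  have V: "V2 \<union> X \<subset> V" "V2 \<union> X \<noteq> {}" "finite V1" "finite X" "V1 \<inter> X = {}" "is_clique X"
    using sep fin by (auto simp: separation_def)
  obtain A where A: "A \<subseteq> V2 \<union> X" "perfect_on A"
    and hit: "\<And>Q. Q \<subseteq> V2 \<union> X \<Longrightarrow> is_clique Q \<Longrightarrow> card Q = omega V \<Longrightarrow> Q \<inter> A \<noteq> {}"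
    using critical_part_divides[OF fin crit V(1,2)] by metis
  have "perfect_on (V1 \<union> (A \<inter> X))"
    by (rule perfect_on_subset[OF perfect_on_two_cliques[of V1 X]]) (use V cl in auto)
  moreover have "perfect_on ((A \<inter> V2) \<union> (A \<inter> X))"
    using A(2) by (rule perfect_on_subset) auto
  ultimately have "perfect_on (V1 \<union> (A \<inter> V2) \<union> (A \<inter> X))"
    by (intro perfect_on_Un_separation[OF fin sep]) auto
  moreover have "V1 \<union> (A \<inter> V2) \<union> (A \<inter> X) \<subseteq> V" using sep by (auto simp: separation_def)
  ultimately obtain Q where Q: "Q \<subseteq> V - (V1 \<union> (A \<inter> V2) \<union> (A \<inter> X))" "is_clique Q" "card Q = omega V"
    using not_divisible_clique[OF fin] crit unfolding critical_def by metis
  then have "Q \<subseteq> V2 \<union> X" "Q \<inter> A = {}" using sep A(1) by (auto simp: separation_def)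
  then show False using hit Q by blast
qed

text \<open>In a claw-free set, a neighbour of \<open>x\<close> on one side forces the neighbours of
  \<open>x\<close> on the other side to form a clique; hence the interest in separations attached on
  both sides.\<close>

definition attached :: "'a set \<Rightarrow> 'a set \<Rightarrow> bool" where
  "attached X V1 \<longleftrightarrow> (\<forall>x\<in>X. nbrs V1 x \<noteq> {})"

text \<open>Vertices of \<open>X\<close> without neighbours in \<open>V2\<close> may change over to
  \<open>V1\<close>. As \<open>V2\<close> stays the same, the others keep their neighbours in
  it.\<close>

lemma separation_drop_unattached:
  assumes "separation V X V1 V2"
  shows "separation V {x\<in>X. nbrs V2 x \<noteq> {}} (V1 \<union> {x\<in>X. nbrs V2 x = {}}) V2"
    and "attached {x\<in>X. nbrs V2 x \<noteq> {}} V2"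
  using assms unfolding separation_def attached_def
  by (auto simp: nbrs_def elim!: clique_subset)

lemma attached_mono: "attached X V1 \<Longrightarrow> Y \<subseteq> X \<Longrightarrow> V1 \<subseteq> V1' \<Longrightarrow> attached Y V1'"
  unfolding attached_def nbrs_def by blast

text \<open>Unattached vertices are dropped first for \<open>V1\<close>, then for the other side.
  The second pass shrinks the cutset and enlarges \<open>V1\<close>, which preserves attachment to
  it.\<close>

lemma separation_attached:
  assumes "separation V X V1 V2"
  obtains X' V1' V2' where "separation V X' V1' V2'" "attached X' V1'" "attached X' V2'"
proof -
  let ?X = "{x\<in>X. nbrs V1 x \<noteq> {}}" and ?V2 = "V2 \<union> {x\<in>X. nbrs V1 x = {}}"
  note drop1 = separation_drop_unattached[OF separation_sym[OF assms]]
  note drop2 = separation_drop_unattached[OF separation_sym[OF drop1(1)]]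
  show thesis
    by (rule that[OF drop2(1) _ drop2(2)], rule attached_mono[OF drop1(2)]) auto
qed

text \<open>
  \<open>A1\<close> and \<open>A2\<close> are the perfect parts of divisions of \<open>V1\<close> and \<open>V2 \<union> X\<close>. Vertices of \<open>X\<close> with equal
  \<open>N2\<close> lie in the same maximum cliques of \<open>V2 \<union> X\<close>, so one representative in \<open>P\<close> per class of
  \<open>A2 \<inter> X\<close> suffices there. On representatives \<open>N1\<close> is a chain, which keeps \<open>A1 \<union> P\<close> perfect, and
  \<open>g \<in> P\<close> lies in all maximum cliques of \<open>V1 \<union> X\<close> that meet \<open>X\<close>.
\<close>

lemma separation_greatest_not_critical:
  assumes fin: "finite V" and sep: "separation V X V1 V2"
    and cl1: "\<And>x. x \<in> X \<Longrightarrow> is_clique (nbrs V1 x)"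
    and cl2: "\<And>x. x \<in> X \<Longrightarrow> is_clique (nbrs V2 x)"
    and cmp: "\<And>x y. x \<in> X \<Longrightarrow> y \<in> X \<Longrightarrow> nbrs V1 x \<subseteq> nbrs V1 y \<or> nbrs V2 x \<subseteq> nbrs V2 y"
    and gr: "\<exists>g\<in>X. \<forall>y\<in>X. nbrs V1 y \<subseteq> nbrs V1 g"
  shows "\<not> critical V"
proof
  assume crit: "critical V"
  have V: "V = V1 \<union> X \<union> V2" "V1 \<subset> V" "V1 \<noteq> {}" "V2 \<union> X \<subset> V" "V2 \<union> X \<noteq> {}"
    and disj: "V1 \<inter> X = {}" "V1 \<inter> V2 = {}" "X \<inter> V2 = {}" and clX: "is_clique X"
    using sep by (auto simp: separation_def)
  have finX: "finite X" "finite V1" "finite V2" using fin V(1) by auto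
  obtain A1 where A1: "A1 \<subseteq> V1" "perfect_on A1"
    and hit1: "\<And>Q. Q \<subseteq> V1 \<Longrightarrow> is_clique Q \<Longrightarrow> card Q = omega V \<Longrightarrow> Q \<inter> A1 \<noteq> {}"
    using critical_part_divides[OF fin crit V(2,3)] by metis
  obtain A2 where A2: "A2 \<subseteq> V2 \<union> X" "perfect_on A2"
    and hit2: "\<And>Q. Q \<subseteq> V2 \<union> X \<Longrightarrow> is_clique Q \<Longrightarrow> card Q = omega V \<Longrightarrow> Q \<inter> A2 \<noteq> {}"
    using critical_part_divides[OF fin crit V(4,5)] by metis
  have finA: "finite A1" "finite A2" using A1(1) A2(1) finX finite_subset by blast+
  \<comment> \<open>A greatest \<open>g\<close> inside \<open>A2\<close> is preferred. If there is
    none, comparability puts \<open>nbrs V2 g\<close> below \<open>nbrs V2 p\<close> for all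
    \<open>p\<close> in \<open>A2 \<inter> X\<close>, so that the neighbours of \<open>g\<close> in
    \<open>A2\<close> form a clique.\<close>
  obtain g where g: "g \<in> X" "\<And>y. y \<in> X \<Longrightarrow> nbrs V1 y \<subseteq> nbrs V1 g"
    and perf_g: "perfect_on (insert g A2)"
  proof (cases "\<exists>p\<in>A2 \<inter> X. \<forall>y\<in>X. nbrs V1 y \<subseteq> nbrs V1 p")
    case True
    then obtain p where "p \<in> A2" "p \<in> X" "\<forall>y\<in>X. nbrs V1 y \<subseteq> nbrs V1 p" by auto
    then show thesis using that[of p] A2(2) by (simp add: insert_absorb)
  next
    case False
    obtain g where g: "g \<in> X" "\<And>y. y \<in> X \<Longrightarrow> nbrs V1 y \<subseteq> nbrs V1 g" using gr by auto
    have above: "nbrs V2 g \<subseteq> nbrs V2 p" if p: "p \<in> A2 \<inter> X" for p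
    proof (rule ccontr)
      assume "\<not> nbrs V2 g \<subseteq> nbrs V2 p"
      then have "nbrs V1 g \<subseteq> nbrs V1 p" using cmp[OF g(1), of p] p by auto
      then have "\<forall>y\<in>X. nbrs V1 y \<subseteq> nbrs V1 p" using g(2) by blast
      then show False using False p by blast
    qed
    have "is_clique (nbrs V2 g \<union> (A2 \<inter> X))"
    proof (rule clique_Un)
      show "is_clique (A2 \<inter> X)" using clX by (rule clique_subset) auto
      show "E u v" if "u \<in> nbrs V2 g" "v \<in> A2 \<inter> X" for u v
        using above[OF that(2)] that(1) adj_sym[of v u] by auto
    qed (rule cl2[OF g(1)])
    then have "is_clique (nbrs A2 g)"
      by (rule clique_subset) (use A2(1) in auto)
    then have "perfect_on (insert g A2)" by (rule perfect_on_insert_simplicial[OF finA(2) A2(2)])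
    then show thesis using that[of g] g by blast
  qed
  define P0 where "P0 = insert g (A2 \<inter> X)"
  \<comment> \<open>\<open>U\<close> gets one vertex for each class other than that of
    \<open>g\<close>, which \<open>g\<close> represents itself.\<close>
  have "\<exists>U\<subseteq>P1. inj_on (nbrs V2) U \<and> nbrs V2 ` P1 = nbrs V2 ` U" for P1
    by (rule subset_image_inj[THEN iffD1, OF subset_refl])
  from this[of "{p\<in>P0. nbrs V2 p \<noteq> nbrs V2 g}"]
  obtain U where U: "U \<subseteq> {p\<in>P0. nbrs V2 p \<noteq> nbrs V2 g}" "inj_on (nbrs V2) U"
    "nbrs V2 ` {p\<in>P0. nbrs V2 p \<noteq> nbrs V2 g} = nbrs V2 ` U"
    by metis
  define P where "P = insert g U"
  have P: "P \<subseteq> X" "g \<in> P" "P \<subseteq> insert g A2" "finite P" "is_clique P"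
    using U(1) g(1) finX(1) clX by (auto simp: P_def P0_def intro: finite_subset clique_subset)
  have inj: "x = y" if "x \<in> P" "y \<in> P" "nbrs V2 x = nbrs V2 y" for x y
    using that U(1) inj_onD[OF U(2), of x y] by (auto simp: P_def)
  have rep: "\<exists>r\<in>P. nbrs V2 r = nbrs V2 p" if "p \<in> A2 \<inter> X" for p
  proof (cases "nbrs V2 p = nbrs V2 g")
    case True
    then show ?thesis using P(2) by auto
  next
    case False
    then have "nbrs V2 p \<in> nbrs V2 ` U" using that U(3) by (auto simp: P0_def)
    then show ?thesis by (auto simp: P_def)
  qed
  \<comment> \<open>Two representatives with incomparable \<open>nbrs V1\<close> would have equal
    \<open>nbrs V2\<close> by \<open>cmp\<close> in both directions, against
    \<open>inj\<close>.\<close>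
  have chain: "nbrs V1 x \<subseteq> nbrs V1 y \<or> nbrs V1 y \<subseteq> nbrs V1 x" if xy: "x \<in> P" "y \<in> P" for x y
  proof (rule ccontr)
    assume "\<not> ?thesis"
    then have "nbrs V2 x = nbrs V2 y" "x \<noteq> y"
      using cmp[of x y] cmp[of y x] xy P(1) by auto
    then show False using inj xy by auto
  qed
  have "perfect_on (A1 \<union> P)"
  proof (rule perfect_on_Un_chain)
    have nb: "nbrs A1 x = nbrs V1 x \<inter> A1" for x using A1(1) by auto
    show "is_clique (nbrs A1 p)" if "p \<in> P" for p
      using cl1[of p] that P(1) by (auto simp: nb intro: clique_subset)
    show "nbrs A1 p \<subseteq> nbrs A1 q \<or> nbrs A1 q \<subseteq> nbrs A1 p" if "p \<in> P" "q \<in> P" for p q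
      using chain[OF that] unfolding nb by blast
  qed (use finA A1 P in auto)
  moreover have "perfect_on ((A2 \<inter> V2) \<union> P)"
    using perf_g by (rule perfect_on_subset) (use P(3) in auto)
  ultimately have "perfect_on (A1 \<union> (A2 \<inter> V2) \<union> P)"
    using A1(1) P(1) by (intro perfect_on_Un_separation[OF fin sep]) auto
  moreover have "A1 \<union> (A2 \<inter> V2) \<union> P \<subseteq> V" using A1(1) P(1) V(1) by auto
  moreover have "\<not> divisible V" using crit by (simp add: critical_def)
  ultimately obtain Q where Q: "Q \<subseteq> V - (A1 \<union> (A2 \<inter> V2) \<union> P)" "is_clique Q" "card Q = omega V"
    using not_divisible_clique[OF fin] by metis
  have QV: "Q \<subseteq> V" "g \<in> V" using Q(1) g(1) V(1) by auto
  \<comment> \<open>\<open>Q\<close> would absorb a vertex of \<open>P\<close> adjacent to all its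
    other vertices, yet it avoids \<open>P\<close>.\<close>
  have no: False if "r \<in> P" "\<And>u. u \<in> Q \<Longrightarrow> u \<noteq> r \<Longrightarrow> E r u" for r
  proof -
    have "r \<in> Q" using max_clique_absorbs[OF fin QV(1) Q(2,3) _ that(2)] that(1) P(1) V(1) by blast
    then show False using Q(1) that(1) by auto
  qed
  have X_adj: "E x y" if "x \<in> X" "y \<in> X" "x \<noteq> y" for x y
    using clX that by (auto simp: is_clique_def)
  have Q_adj: "E x y" if "x \<in> Q" "y \<in> Q" "x \<noteq> y" for x y
    using Q(2) that by (auto simp: is_clique_def)
  consider "Q \<subseteq> V1" | q where "Q \<subseteq> V1 \<union> X" "q \<in> Q" "q \<in> X" | "Q \<subseteq> V2 \<union> X"
    using clique_across_separation[OF sep Q(2) QV(1)] by blast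
  then show False
  proof cases
    case 1
    then show False using hit1[OF 1 Q(2,3)] Q(1) by auto
  next
    case 2
    show False
    proof (rule no[OF P(2)])
      fix u assume u: "u \<in> Q" "u \<noteq> g"
      show "E g u"
      proof (cases "u \<in> X")
        case True
        then show ?thesis using X_adj g(1) u by auto
      next
        case False
        then have "u \<in> nbrs V1 q" using u 2 Q_adj[of q u] by auto
        then show ?thesis using g(2)[OF 2(3)] by auto
      qed
    qed
  next
    case 3
    \<comment> \<open>\<open>A2\<close> meets \<open>Q\<close>, and only within \<open>X\<close>,
      because \<open>Q\<close> avoids \<open>A2 \<inter> V2\<close>. The representative
      \<open>r\<close> then has the adjacencies of \<open>p\<close>.\<close>
    then obtain p where "p \<in> Q" "p \<in> A2" using hit2[OF 3 Q(2,3)] by auto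
    then have p: "p \<in> Q" "p \<in> A2 \<inter> X" using 3 Q(1) by auto
    then obtain r where r: "r \<in> P" "nbrs V2 r = nbrs V2 p" using rep by blast
    show False
    proof (rule no[OF r(1)])
      fix u assume u: "u \<in> Q" "u \<noteq> r"
      show "E r u"
      proof (cases "u \<in> X")
        case True
        then show ?thesis using X_adj r(1) P(1) u by auto
      next
        case False
        then have "u \<in> nbrs V2 p" using u 3 p Q_adj[of p u] by auto
        then show ?thesis using r(2) by auto
      qed
    qed
  qed
qed

section \<open>Claw-free vertex sets\<close>

definition claw_free :: "'a set \<Rightarrow> bool" where
  "claw_free V \<longleftrightarrow> \<not> (\<exists>x\<in>V. \<exists>a\<in>V. \<exists>b\<in>V. \<exists>c\<in>V. E x a \<and> E x b \<and> E x c \<and>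
     a \<noteq> b \<and> a \<noteq> c \<and> b \<noteq> c \<and> \<not> E a b \<and> \<not> E a c \<and> \<not> E b c)"

lemma claw_freeD:
  assumes "claw_free V" "x \<in> V" "a \<in> V" "b \<in> V" "c \<in> V" "E x a" "E x b" "E x c"
    "a \<noteq> b" "a \<noteq> c" "b \<noteq> c" "\<not> E a c" "\<not> E b c"
  shows "E a b"
  using assms unfolding claw_free_def by metis

text \<open>Two nonadjacent neighbours of \<open>x\<close> in \<open>V1\<close> and a neighbour of
  \<open>x\<close> in \<open>V2\<close> would be the leaves of a claw with centre
  \<open>x\<close>.\<close>

lemma claw_free_nbrs_clique:
  assumes cf: "claw_free V" and sep: "separation V X V1 V2" and att: "attached X V2" and x: "x \<in> X"
  shows "is_clique (nbrs V1 x)"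
  unfolding is_clique_def
proof (intro ballI impI)
  fix a b assume ab: "a \<in> nbrs V1 x" "b \<in> nbrs V1 x" "a \<noteq> b"
  obtain c where c: "c \<in> nbrs V2 x" using att x unfolding attached_def by blast
  have V: "V = V1 \<union> X \<union> V2" "V1 \<inter> V2 = {}" "\<And>u v. u \<in> V1 \<Longrightarrow> v \<in> V2 \<Longrightarrow> \<not> E u v"
    using sep by (auto simp: separation_def)
  show "E a b"
    by (rule claw_freeD[OF cf, of x a b c]) (use ab c x V in auto)
qed

text \<open>If both inclusions fail, witnesses \<open>a\<close> and \<open>b\<close> together with
  \<open>y\<close> are the leaves of a claw with centre \<open>x\<close>.\<close>

lemma claw_free_nbrs_comparable:
  assumes cf: "claw_free V" and sep: "separation V X V1 V2" and x: "x \<in> X" and y: "y \<in> X"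
  shows "nbrs V1 x \<subseteq> nbrs V1 y \<or> nbrs V2 x \<subseteq> nbrs V2 y"
proof (rule ccontr)
  assume "\<not> ?thesis"
  then obtain a b where ab: "a \<in> nbrs V1 x" "a \<notin> nbrs V1 y" "b \<in> nbrs V2 x" "b \<notin> nbrs V2 y" by blast
  have V: "V = V1 \<union> X \<union> V2" "V1 \<inter> X = {}" "V1 \<inter> V2 = {}" "X \<inter> V2 = {}"
    "\<And>u v. u \<in> V1 \<Longrightarrow> v \<in> V2 \<Longrightarrow> \<not> E u v" "is_clique X"
    using sep by (auto simp: separation_def)
  have "x \<noteq> y" using ab by auto
  then have xy: "E x y" using V(6) x y by (auto simp: is_clique_def)
  have "E y a"
    by (rule claw_freeD[OF cf, of x y a b]) (use ab x y xy V in auto)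
  then show False using ab by auto
qed

text \<open>Take \<open>x\<close> with largest \<open>nbrs V1 x\<close>. If this set is not
  greatest, it is incomparable with some \<open>nbrs V1 z\<close>, so
  \<open>nbrs V2 x = nbrs V2 z\<close>. A \<open>y\<close> violating leastness of this common set
  would have \<open>nbrs V1 y\<close> above both, hence larger than
  \<open>nbrs V1 x\<close>.\<close>

lemma greatest_or_least_nbrs:
  assumes "finite X" "X \<noteq> {}" "finite V1"
    and cmp: "\<And>x y. x \<in> X \<Longrightarrow> y \<in> X \<Longrightarrow> nbrs V1 x \<subseteq> nbrs V1 y \<or> nbrs V2 x \<subseteq> nbrs V2 y"
  shows "(\<exists>g\<in>X. \<forall>y\<in>X. nbrs V1 y \<subseteq> nbrs V1 g) \<or> (\<exists>l\<in>X. \<forall>y\<in>X. nbrs V2 l \<subseteq> nbrs V2 y)"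
proof -
  have finN: "finite (nbrs V1 y)" for y using assms(3) by (simp add: nbrs_def)
  obtain x where x: "x \<in> X" "\<And>y. y \<in> X \<Longrightarrow> card (nbrs V1 y) \<le> card (nbrs V1 x)"
  proof -
    have "finite ((\<lambda>y. card (nbrs V1 y)) ` X)" "(\<lambda>y. card (nbrs V1 y)) ` X \<noteq> {}"
      using assms by auto
    from Max_in[OF this] Max_ge[OF this(1)] show thesis using that by auto
  qed
  show ?thesis
  proof (cases "\<forall>y\<in>X. nbrs V1 y \<subseteq> nbrs V1 x")
    case True
    then show ?thesis using x(1) by blast
  next
    case False
    then obtain z where z: "z \<in> X" "\<not> nbrs V1 z \<subseteq> nbrs V1 x" by blast
    have "\<not> nbrs V1 x \<subseteq> nbrs V1 z"
      using z x(2)[OF z(1)] card_seteq[OF finN, of "nbrs V1 x" z] by auto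
    then have eq: "nbrs V2 x = nbrs V2 z" using cmp[OF x(1) z(1)] cmp[OF z(1) x(1)] z(2) by auto
    have "nbrs V2 x \<subseteq> nbrs V2 y" if y: "y \<in> X" for y
    proof (rule ccontr)
      assume *: "\<not> nbrs V2 x \<subseteq> nbrs V2 y"
      then have "nbrs V1 x \<subseteq> nbrs V1 y" "nbrs V1 z \<subseteq> nbrs V1 y"
        using cmp[OF x(1) y] cmp[OF z(1) y] eq by auto
      then have "nbrs V1 x \<subset> nbrs V1 y" using z(2) by blast
      then show False using psubset_card_mono[OF finN[of y]] x(2)[OF y] by (metis leD)
    qed
    then show ?thesis using x(1) by blast
  qed
qed

text \<open>This is connectedness in terms of edges leaving nontrivial subsets, a form that a
  separation with empty \<open>X\<close> violates at once.\<close>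

definition linked :: "'a set \<Rightarrow> bool" where
  "linked V \<longleftrightarrow> (\<forall>U\<subseteq>V. U \<noteq> {} \<longrightarrow> U \<noteq> V \<longrightarrow> (\<exists>u\<in>U. \<exists>v\<in>V - U. E u v))"

lemma linked_separation: "linked V \<Longrightarrow> separation V X V1 V2 \<Longrightarrow> X \<noteq> {}"
  unfolding linked_def separation_def
  by (elim allE[of _ V1]) auto

lemma claw_free_not_critical:
  assumes fin: "finite V" and cf: "claw_free V" and con: "linked V" and sep: "separation V X V1 V2"
  shows "\<not> critical V"
proof
  assume crit: "critical V"
  let ?good = "\<lambda>(X, V1, V2). separation V X V1 V2 \<and> attached X V1 \<and> attached X V2"
  obtain X0 V10 V20 where "separation V X0 V10 V20" "attached X0 V10" "attached X0 V20"
    by (rule separation_attached[OF sep])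
  then have "?good (X0, V10, V20)" by simp
  \<comment> \<open>Minimality is among separations attached on both sides; the smaller separation
    built below must therefore be made attached as well.\<close>
  from ex_has_least_nat[of ?good, OF this, of "\<lambda>(X, V1, V2). card V2"]
  obtain Y W1 W2 where sepY: "separation V Y W1 W2" and att: "attached Y W1" "attached Y W2"
    and least: "\<And>X' V1' V2'. separation V X' V1' V2' \<Longrightarrow> attached X' V1' \<Longrightarrow> attached X' V2'
      \<Longrightarrow> card W2 \<le> card V2'"
    by auto
  have V: "V = W1 \<union> Y \<union> W2" and clY: "is_clique Y"
    and disj: "W1 \<inter> Y = {}" "W1 \<inter> W2 = {}" "Y \<inter> W2 = {}" "W1 \<noteq> {}" "W2 \<noteq> {}"
    and no_edge: "\<And>u v. u \<in> W1 \<Longrightarrow> v \<in> W2 \<Longrightarrow> \<not> E u v"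
    using sepY by (auto simp: separation_def)
  have finW: "finite W1" "finite W2" "finite Y" using fin V by auto
  have cl1: "is_clique (nbrs W1 x)" if "x \<in> Y" for x
    using claw_free_nbrs_clique[OF cf sepY att(2) that] .
  have cl2: "is_clique (nbrs W2 x)" if "x \<in> Y" for x
    using claw_free_nbrs_clique[OF cf separation_sym[OF sepY] att(1) that] .
  have cmp: "nbrs W1 x \<subseteq> nbrs W1 y \<or> nbrs W2 x \<subseteq> nbrs W2 y" if "x \<in> Y" "y \<in> Y" for x y
    using claw_free_nbrs_comparable[OF cf sepY that] .
  have "\<not> (\<exists>g\<in>Y. \<forall>y\<in>Y. nbrs W1 y \<subseteq> nbrs W1 g)"
    using separation_greatest_not_critical[OF fin sepY cl1 cl2 cmp] crit by blast
  then obtain l where l: "l \<in> Y" "\<And>y. y \<in> Y \<Longrightarrow> nbrs W2 l \<subseteq> nbrs W2 y"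
    using greatest_or_least_nbrs[OF finW(3) linked_separation[OF con sepY] finW(1) cmp] by blast
  \<comment> \<open>\<open>l\<close> leaves the cutset and is replaced by its neighbours in
    \<open>W2\<close>. As \<open>nbrs W2 l\<close> is least, these are adjacent to all of
    \<open>Y\<close>.\<close>
  define X' where "X' = (Y - {l}) \<union> nbrs W2 l"
  define V1' where "V1' = insert l W1"
  define V2' where "V2' = W2 - nbrs W2 l"
  \<comment> \<open>Equality would make the whole side \<open>W2\<close> a clique.\<close>
  have "nbrs W2 l \<noteq> W2"
    using separation_clique_side[OF fin separation_sym[OF sepY]] cl2[OF l(1)] crit by auto
  then have V2'_ne: "V2' \<noteq> {}" by (auto simp: V2'_def)
  have clX': "is_clique X'"
    unfolding X'_def
  proof (rule clique_Un)
    show "is_clique (Y - {l})" using clY by (rule clique_subset) auto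
    show "E u v" if "u \<in> Y - {l}" "v \<in> nbrs W2 l" for u v
      using l(2)[of u] that by auto
  qed (rule cl2[OF l(1)])
  have "separation V X' V1' V2'"
    unfolding separation_def
  proof (intro conjI ballI)
    show "V = V1' \<union> X' \<union> V2'" using V l(1) by (auto simp: X'_def V1'_def V2'_def)
    show "V1' \<inter> X' = {}" "V1' \<inter> V2' = {}" "X' \<inter> V2' = {}"
      using disj l(1) adj_irrefl by (auto simp: X'_def V1'_def V2'_def)
    show "\<not> E u v" if "u \<in> V1'" "v \<in> V2'" for u v
      using that no_edge by (auto simp: V1'_def V2'_def)
  qed (use V2'_ne clX' in \<open>auto simp: V1'_def\<close>)
  note drop = separation_drop_unattached[OF this]
  have "attached X' V1'"
    unfolding attached_def
  proof
    fix x assume x: "x \<in> X'"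
    \<comment> \<open>The vertex \<open>l\<close>, now in \<open>V1'\<close>, is adjacent to all of
      \<open>X'\<close>.\<close>
    have "E x l"
    proof (cases "x \<in> Y")
      case True
      then have "x \<noteq> l" using x l(1) disj by (auto simp: X'_def)
      then show ?thesis using clY True l(1) by (auto simp: is_clique_def)
    next
      case False
      then show ?thesis using x adj_sym[of l x] by (auto simp: X'_def)
    qed
    then show "nbrs V1' x \<noteq> {}" by (auto simp: V1'_def nbrs_def)
  qed
  \<comment> \<open>Dropping the vertices of \<open>X'\<close> without neighbours in
    \<open>V2'\<close> makes the separation attached on both sides and leaves \<open>V2'\<close>
    unchanged.\<close>
  then have "card W2 \<le> card V2'"
    by (intro least[OF drop(1) _ drop(2)]) (auto elim: attached_mono)
  moreover have "V2' \<subset> W2"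
  proof -
    obtain u where "u \<in> nbrs W2 l" using att(2) l(1) unfolding attached_def by blast
    then show ?thesis by (auto simp: V2'_def)
  qed
  ultimately show False using psubset_card_mono[OF finW(2)] by (metis leD)
qed

section \<open>Vertex sets without two separate induced paths on three vertices\<close>

definition two_P3_free :: "'a set \<Rightarrow> bool" where
  "two_P3_free V \<longleftrightarrow> \<not> (\<exists>a b c a' b' c'. {a, b, c, a', b', c'} \<subseteq> V \<and>
     E a b \<and> E b c \<and> a \<noteq> c \<and> \<not> E a c \<and> E a' b' \<and> E b' c' \<and> a' \<noteq> c' \<and> \<not> E a' c' \<and>
     (\<forall>u\<in>{a,b,c}. \<forall>v\<in>{a',b',c'}. u \<noteq> v \<and> \<not> E u v))"

text \<open>Without induced paths on three vertices, the components of \<open>V1\<close> are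
  cliques. One of them serves as a clique side, and the others move over to
  \<open>V2\<close>.\<close>

lemma no_P3_not_critical:
  assumes fin: "finite V" and sep: "separation V X V1 V2"
    and noP3: "\<And>a b c. a \<in> V1 \<Longrightarrow> b \<in> V1 \<Longrightarrow> c \<in> V1 \<Longrightarrow> E a b \<Longrightarrow> E b c \<Longrightarrow> a \<noteq> c \<Longrightarrow> E a c"
  shows "\<not> critical V"
proof -
  have V: "V = V1 \<union> X \<union> V2" "is_clique X" and disj: "V1 \<inter> X = {}" "V1 \<inter> V2 = {}" "X \<inter> V2 = {}" "V1 \<noteq> {}" "V2 \<noteq> {}"
    and no_edge: "\<And>u v. u \<in> V1 \<Longrightarrow> v \<in> V2 \<Longrightarrow> \<not> E u v"
    using sep by (auto simp: separation_def)
  obtain v where v: "v \<in> V1" using disj by auto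
  define K where "K = insert v (nbrs V1 v)"
  have K: "K \<subseteq> V1" using v by (auto simp: K_def)
  have clK: "is_clique K"
    unfolding is_clique_def
  proof (intro ballI impI)
    fix a b assume ab: "a \<in> K" "b \<in> K" "a \<noteq> b"
    then show "E a b"
      using v adj_sym[of v a] noP3[of a v b] by (auto simp: K_def)
  qed
  have sepK: "separation V X K (V2 \<union> (V1 - K))"
    unfolding separation_def
  proof (intro conjI ballI)
    fix u w assume u: "u \<in> K" and w: "w \<in> V2 \<union> (V1 - K)"
    show "\<not> E u w"
    proof
      assume "E u w"
      then have "w \<in> V1 - K" using no_edge[of u w] u w K by auto
      then have "u \<in> nbrs V1 v" using \<open>E u w\<close> u by (auto simp: K_def)
      \<comment> \<open>An edge from \<open>u\<close> to \<open>w\<close> outside \<open>K\<close>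
        would make \<open>v\<close>, \<open>u\<close>, \<open>w\<close> an induced path.\<close>
      then show False using noP3[of v u w] \<open>E u w\<close> \<open>w \<in> V1 - K\<close> v by (auto simp: K_def)
    qed
  qed (use V disj K v in \<open>auto simp: K_def\<close>)
  show ?thesis using separation_clique_side[OF fin sepK clK] .
qed

text \<open>In the critical case each side contains an induced path on three vertices, and no edge
  joins the sides.\<close>

lemma two_P3_free_not_critical:
  assumes fin: "finite V" and free: "two_P3_free V" and sep: "separation V X V1 V2"
  shows "\<not> critical V"
proof (rule ccontr)
  assume crit: "\<not> \<not> critical V"
  have V: "V = V1 \<union> X \<union> V2" "V1 \<inter> V2 = {}"
    and no_edge: "\<And>u v. u \<in> V1 \<Longrightarrow> v \<in> V2 \<Longrightarrow> \<not> E u v"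
    using sep by (auto simp: separation_def)
  obtain a b c where abc: "a \<in> V1" "b \<in> V1" "c \<in> V1" "E a b" "E b c" "a \<noteq> c" "\<not> E a c"
    using no_P3_not_critical[OF fin sep] crit by blast
  obtain a' b' c' where abc': "a' \<in> V2" "b' \<in> V2" "c' \<in> V2" "E a' b'" "E b' c'" "a' \<noteq> c'" "\<not> E a' c'"
    using no_P3_not_critical[OF fin separation_sym[OF sep]] crit by blast
  have "\<forall>u\<in>{a,b,c}. \<forall>v\<in>{a',b',c'}. u \<noteq> v \<and> \<not> E u v"
    using abc(1-3) abc'(1-3) no_edge V(2) by auto
  moreover have "{a,b,c,a',b',c'} \<subseteq> V" using abc(1-3) abc'(1-3) V(1) by auto
  ultimately have "\<not> two_P3_free V"
    unfolding two_P3_free_def not_not using abc(4-7) abc'(4-7)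
    by (intro exI[of _ a] exI[of _ b] exI[of _ c] exI[of _ a'] exI[of _ b'] exI[of _ c'] conjI)
  then show False using free by contradiction
qed

end

section \<open>Transfer to graphs\<close>

lemma dominates_induce [simp]:
  "u \<rightarrow>\<^bsub>G \<restriction> S\<^esub> v \<longleftrightarrow> u \<rightarrow>\<^bsub>G\<^esub> v \<and> u \<in> S \<and> v \<in> S"
  by (auto simp: arcs_ends_conv)

lemma induce_induce: "T \<subseteq> S \<Longrightarrow> (G \<restriction> S) \<restriction> T = G \<restriction> T"
  by (auto simp: induce_subgraph_def)

lemma (in wf_digraph) induce_verts: "G \<restriction> verts G = G"
  by (rule induce_eq_iff_induced) (rule induced_subgraph_refl)

sublocale graph \<subseteq> adj: adjacency "\<lambda>u v. u \<rightarrow>\<^bsub>G\<^esub> v"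
proof
  show "v \<rightarrow>\<^bsub>G\<^esub> u" if "u \<rightarrow>\<^bsub>G\<^esub> v" for u v
    using sym_arcs that by (rule arcs_ends_symmetric)
  show "\<not> u \<rightarrow>\<^bsub>G\<^esub> u" for u
    using adj_not_same by auto
qed

text \<open>This turns quantifiers over induced subgraphs into quantifiers over vertex sets, as in
  \<open>perfect_on\<close> and \<open>divisible\<close>.\<close>

lemma induced_subgraph_of_induce:
  assumes "wf_digraph G"
  shows "induced_subgraph H (G \<restriction> S) \<longleftrightarrow> (\<exists>T\<subseteq>S. H = G \<restriction> T)"
proof -
  interpret wf_digraph "G \<restriction> S" by (rule wf_digraph.wellformed_induce_subgraph[OF assms])
  show ?thesis
  proof
    assume H: "induced_subgraph H (G \<restriction> S)"
    then have "verts H \<subseteq> S" by (auto simp: induced_subgraph_def subgraph_def)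
    moreover have "H = G \<restriction> verts H"
      using induce_eq_iff_induced[OF H] induce_induce[OF \<open>verts H \<subseteq> S\<close>] by metis
    ultimately show "\<exists>T\<subseteq>S. H = G \<restriction> T" by blast
  next
    assume "\<exists>T\<subseteq>S. H = G \<restriction> T"
    then obtain T where "T \<subseteq> S" "H = (G \<restriction> S) \<restriction> T" using induce_induce by metis
    then show "induced_subgraph H (G \<restriction> S)" using induced_induce[of T] by simp
  qed
qed

text \<open>By symmetry connectedness is strong connectedness. A set that no edge leaves contains
  everything reachable from it; conversely, no edge leaves the set reachable from
  \<open>u\<close>.\<close>

lemma (in sym_digraph) connected_iff_cuts:
  "Digraph_Component.connected G \<longleftrightarrow> verts G \<noteq> {} \<and>
    (\<forall>U\<subseteq>verts G. U \<noteq> {} \<longrightarrow> U \<noteq> verts G \<longrightarrow> (\<exists>u\<in>U. \<exists>v\<in>verts G - U. u \<rightarrow>\<^bsub>G\<^esub> v))"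
    (is "_ \<longleftrightarrow> _ \<and> ?cuts")
proof (intro iffI conjI)
  assume con: "Digraph_Component.connected G"
  then have sc: "strongly_connected G"
    using symmetric_connected_imp_strongly_connected sym_arcs by blast
  then show "verts G \<noteq> {}" by (simp add: strongly_connected_def)
  show ?cuts
  proof (intro allI impI)
    fix U assume U: "U \<subseteq> verts G" "U \<noteq> {}" "U \<noteq> verts G"
    then obtain u v where uv: "u \<in> U" "v \<in> verts G" "v \<notin> U" by blast
    then have "u \<rightarrow>\<^sup>* v" using sc U(1) unfolding strongly_connected_def by blast
    show "\<exists>u\<in>U. \<exists>v\<in>verts G - U. u \<rightarrow>\<^bsub>G\<^esub> v"
    proof (rule ccontr)
      assume no: "\<not> ?thesis"
      from \<open>u \<rightarrow>\<^sup>* v\<close> have "v \<in> U"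
      proof (induction rule: reachable_induct)
        case base
        then show ?case using uv by simp
      next
        case (step x y)
        then show ?case using no adj_in_verts[of x y] by blast
      qed
      then show False using uv by simp
    qed
  qed
next
  assume "verts G \<noteq> {} \<and> ?cuts"
  then have ne: "verts G \<noteq> {}" and lk: ?cuts by auto
  have "u \<rightarrow>\<^sup>* v" if uv: "u \<in> verts G" "v \<in> verts G" for u v
  proof (rule ccontr)
    assume "\<not> u \<rightarrow>\<^sup>* v"
    define U where "U = {w. u \<rightarrow>\<^sup>* w}"
    have "U \<subseteq> verts G" "u \<in> U" "v \<notin> U"
      using reachable_in_verts uv \<open>\<not> u \<rightarrow>\<^sup>* v\<close> by (auto simp: U_def)
    then obtain x y where "x \<in> U" "y \<notin> U" "x \<rightarrow>\<^bsub>G\<^esub> y"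
      using lk uv by (metis DiffD2 empty_iff)
    then show False by (auto simp: U_def dest: reachable_adj_trans)
  qed
  then show "Digraph_Component.connected G"
    using ne unfolding connected_def strongly_connected_def
    by (simp add: reachable_mk_symmetric_eq[OF sym_arcs])
qed

text \<open>The subgraph induced on the image of \<open>f\<close> is isomorphic to \<open>F\<close>
  through the inverse of \<open>f\<close>, because \<open>f\<close> preserves and reflects
  adjacency.\<close>

lemma pair_embedding_not_induced_free:
  fixes F :: "'c pair_pre_digraph"
  assumes G: "nomulti_digraph G" and F: "parcs F \<subseteq> pverts F \<times> pverts F"
    and inj: "inj_on f (pverts F)" and sub: "f ` pverts F \<subseteq> verts G"
    and adj: "\<And>i j. i \<in> pverts F \<Longrightarrow> j \<in> pverts F \<Longrightarrow> (i, j) \<in> parcs F \<longleftrightarrow> (f i) \<rightarrow>\<^bsub>G\<^esub> (f j)"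
  shows "\<not> induced_free (with_proj F) G"
proof -
  interpret nomulti_digraph G by (rule G)
  define H where "H = G \<restriction> (f ` pverts F)"
  define g where "g = the_inv_into (pverts F) f"
  have gf: "g (f i) = i" if "i \<in> pverts F" for i
    using the_inv_into_f_f[OF inj that] by (simp add: g_def)
  \<comment> \<open>Arcs of \<open>F\<close> are pairs of vertices, so each arc is sent to the pair
    of preimages of its ends.\<close>
  define h where "h = \<lparr> iso_verts = g, iso_arcs = \<lambda>e. (g (tail G e), g (head G e)),
    iso_head = snd, iso_tail = fst \<rparr>"
  have wfH: "wf_digraph H" unfolding H_def by (rule wellformed_induce_subgraph)
  have inj_g: "inj_on g (f ` pverts F)"
    by (rule inj_onI) (auto simp: gf)
  \<comment> \<open>Arcs with the same ends coincide in the absence of parallel arcs.\<close>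
  have "inj_on (\<lambda>e. (g (tail G e), g (head G e))) (arcs H)"
  proof (rule inj_onI)
    fix e e' assume "e \<in> arcs H" "e' \<in> arcs H"
      "(g (tail G e), g (head G e)) = (g (tail G e'), g (head G e'))"
    then show "e = e'"
      using inj_g no_multi_arcs[of e e'] by (auto simp: H_def arc_to_ends_def dest: inj_onD)
  qed
  then have "pre_digraph.digraph_isomorphism H h"
    using wfH inj_g unfolding pre_digraph.digraph_isomorphism_def by (simp add: h_def H_def)
  moreover have "with_proj F = app_iso h H"
  proof -
    have "g ` f ` pverts F = pverts F" by (force simp: gf)
    moreover have "(\<lambda>e. (g (tail G e), g (head G e))) ` arcs H = parcs F"
    proof (intro equalityI subsetI)
      fix p assume "p \<in> (\<lambda>e. (g (tail G e), g (head G e))) ` arcs H"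
      then obtain e i j where "e \<in> arcs G" "i \<in> pverts F" "j \<in> pverts F"
        "tail G e = f i" "head G e = f j" "p = (i, j)"
        by (auto simp: H_def gf)
      then show "p \<in> parcs F" using adj[of i j] in_arcs_imp_in_arcs_ends[of e] by simp
    next
      fix p assume p: "p \<in> parcs F"
      then obtain i j where ij: "p = (i, j)" "i \<in> pverts F" "j \<in> pverts F" using F by auto
      then obtain e where "e \<in> arcs G" "tail G e = f i" "head G e = f j"
        using adj[of i j] p by auto
      then show "p \<in> (\<lambda>e. (g (tail G e), g (head G e))) ` arcs H"
        using ij by (intro image_eqI[of _ _ e]) (auto simp: H_def gf)
    qed
    ultimately show ?thesis by (simp add: app_iso_def with_proj_def h_def H_def)
  qed
  moreover have "induced_subgraph H G" unfolding H_def by (rule induced_induce[OF sub])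
  ultimately show ?thesis unfolding induced_free_def digraph_iso_def by blast
qed

section \<open>Graph notions as notions of vertex sets\<close>

context graph begin

lemma clique_induce: "clique (G \<restriction> S) X \<longleftrightarrow> X \<subseteq> S \<and> adj.is_clique X"
  by (auto simp: clique_def adj.is_clique_def)

lemma clique_number_induce: "clique_number (G \<restriction> S) = adj.omega S"
  by (simp add: clique_number_def adj.omega_def clique_induce)

lemma proper_colouring_induce:
  "(\<exists>c. proper_colouring (G \<restriction> S) k c) \<longleftrightarrow> adj.colourable S k"
  unfolding proper_colouring_def adj.colourable_def by (intro ex_cong1) auto

text \<open>\<open>card S\<close> colours always suffice, so the least number of colours is
  attained, and \<open>omega\<close> bounds it from below.\<close>

lemma chromatic_number_induce:
  assumes "finite S"
  shows "chromatic_number (G \<restriction> S) = adj.omega S \<longleftrightarrow> adj.colourable S (adj.omega S)"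
proof
  obtain f where f: "bij_betw f S {..<card S}"
    using finite_same_card_bij[OF assms finite_lessThan] by auto
  have "adj.colourable S (card S)"
    unfolding adj.colourable_def
  proof (intro exI[of _ f] conjI ballI impI)
    show "f ` S \<subseteq> {..<card S}" using f by (simp add: bij_betw_def)
    show "f u \<noteq> f v" if "u \<in> S" "v \<in> S" "u \<rightarrow>\<^bsub>G\<^esub> v" for u v
      using that f adj.adj_irrefl[of u] by (auto simp: bij_betw_def dest: inj_onD)
  qed
  then have "adj.colourable S (chromatic_number (G \<restriction> S))"
    unfolding chromatic_number_def proper_colouring_induce by (rule LeastI)
  moreover assume "chromatic_number (G \<restriction> S) = adj.omega S"
  ultimately show "adj.colourable S (adj.omega S)" by simp
next
  assume "adj.colourable S (adj.omega S)"
  then show "chromatic_number (G \<restriction> S) = adj.omega S"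
    unfolding chromatic_number_def proper_colouring_induce
    by (rule Least_equality) (rule adj.omega_le_colours[OF assms])
qed

lemma perfect_graph_induce:
  assumes "finite S"
  shows "perfect_graph (G \<restriction> S) \<longleftrightarrow> adj.perfect_on S"
proof -
  have "perfect_graph (G \<restriction> S) \<longleftrightarrow>
    (\<forall>T\<subseteq>S. chromatic_number (G \<restriction> T) = clique_number (G \<restriction> T))"
    unfolding perfect_graph_def induced_subgraph_of_induce[OF wf_digraph] by blast
  also have "\<dots> \<longleftrightarrow> adj.perfect_on S"
    unfolding adj.perfect_on_def clique_number_induce
    using chromatic_number_induce finite_subset[OF _ assms] by auto
  finally show ?thesis .
qed

lemma perfect_division_induce:
  assumes "finite S"
  shows "(\<exists>A B. perfect_division (G \<restriction> S) A B) \<longleftrightarrow> adj.divisible S"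
proof
  assume "\<exists>A B. perfect_division (G \<restriction> S) A B"
  then obtain A B where AB: "A \<union> B = S" "A \<inter> B = {}" "perfect_graph ((G \<restriction> S) \<restriction> A)"
    "clique_number ((G \<restriction> S) \<restriction> B) < clique_number (G \<restriction> S)"
    by (auto simp: perfect_division_def)
  then have sub: "A \<subseteq> S" "B \<subseteq> S" "S - A = B" "finite A" using assms by auto
  show "adj.divisible S"
    using AB(3,4) perfect_graph_induce[OF sub(4)] sub(1,3)
    unfolding adj.divisible_def induce_induce[OF sub(1)] induce_induce[OF sub(2)] clique_number_induce
    by blast
next
  assume "adj.divisible S"
  then obtain A where A: "A \<subseteq> S" "adj.perfect_on A" "adj.omega (S - A) < adj.omega S"
    unfolding adj.divisible_def by blast
  have "S - A \<subseteq> S" by blast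
  then have "perfect_division (G \<restriction> S) A (S - A)"
    using A perfect_graph_induce[OF finite_subset[OF A(1) assms]]
    by (auto simp: perfect_division_def induce_induce clique_number_induce)
  then show "\<exists>A B. perfect_division (G \<restriction> S) A B" by blast
qed

lemma induced_subgraph_iff: "induced_subgraph H G \<longleftrightarrow> (\<exists>S\<subseteq>verts G. H = G \<restriction> S)"
  using induced_subgraph_of_induce[OF wf_digraph, of H "verts G"] by (simp add: induce_verts)

text \<open>Some nonempty induced subgraph has no perfect division. As all proper ones have, it must
  be \<open>G\<close> itself.\<close>

lemma minimally_nonperfectly_divisible_critical:
  assumes "minimally_nonperfectly_divisible G"
  shows "adj.critical (verts G)"
proof -
  have proper: "adj.divisible S" if "S \<subset> verts G" "S \<noteq> {}" for S
  proof -
    have "G \<restriction> S \<noteq> G" using that by (metis induce_subgraph_verts psubset_eq)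
    then have "perfectly_divisible (G \<restriction> S)"
      using assms that induced_subgraph_iff
      unfolding minimally_nonperfectly_divisible_def by blast
    moreover have "induced_subgraph (G \<restriction> S) (G \<restriction> S)"
      using induced_subgraph_of_induce[OF wf_digraph] by blast
    ultimately have "\<exists>A B. perfect_division (G \<restriction> S) A B"
      using that unfolding perfectly_divisible_def by simp
    then show ?thesis using perfect_division_induce finite_subset[of S "verts G"] that by auto
  qed
  obtain H where H: "induced_subgraph H G" "verts H \<noteq> {}" "\<not> (\<exists>A B. perfect_division H A B)"
    using assms unfolding minimally_nonperfectly_divisible_def perfectly_divisible_def by blast
  then obtain S where S: "S \<subseteq> verts G" "H = G \<restriction> S" using induced_subgraph_iff by auto
  then have "\<not> adj.divisible S"
    using H(3) perfect_division_induce[of S] finite_subset[of S "verts G"] by simp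
  then have "S = verts G" using proper S H(2) by auto
  then show ?thesis using proper \<open>\<not> adj.divisible S\<close> by (auto simp: adj.critical_def)
qed

lemma linked_if_connected: "Digraph_Component.connected G \<Longrightarrow> adj.linked (verts G)"
  unfolding connected_iff_cuts adj.linked_def by blast

text \<open>One side is a nontrivial set that no edge leaves after \<open>X\<close> is deleted; it
  exists by the cut form of connectedness.\<close>

lemma clique_cutset_separation:
  assumes "clique_cutset G X"
  obtains V1 V2 where "adj.separation (verts G) X V1 V2"
proof -
  let ?S = "verts G - X"
  interpret S: sym_digraph "G \<restriction> ?S"
    by (rule induced_graph_imp_graph) (rule induced_induce, blast)
  have X: "X \<subseteq> verts G" "adj.is_clique X"
    using assms by (auto simp: clique_cutset_def clique_def adj.is_clique_def)
  have "?S \<noteq> {}" "\<not> Digraph_Component.connected (G \<restriction> ?S)"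
    using assms by (auto simp: clique_cutset_def disconnected_def)
  then have "\<not> (\<forall>U\<subseteq>?S. U \<noteq> {} \<longrightarrow> U \<noteq> ?S \<longrightarrow> (\<exists>u\<in>U. \<exists>v\<in>?S - U. u \<rightarrow>\<^bsub>G \<restriction> ?S\<^esub> v))"
    unfolding S.connected_iff_cuts induce_subgraph_verts by blast
  then obtain U where U: "U \<subseteq> ?S" "U \<noteq> {}" "U \<noteq> ?S"
    and no_edge: "\<And>u v. u \<in> U \<Longrightarrow> v \<in> ?S - U \<Longrightarrow> \<not> u \<rightarrow>\<^bsub>G \<restriction> ?S\<^esub> v"
    by blast
  have "adj.separation (verts G) X U (?S - U)"
    unfolding adj.separation_def
  proof (intro conjI ballI)
    fix u v assume uv: "u \<in> U" "v \<in> ?S - U"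
    then show "\<not> u \<rightarrow> v" using no_edge[OF uv] U(1) by auto
  qed (use U X in auto)
  then show thesis by (rule that)
qed

section \<open>Forbidden induced subgraphs as forbidden configurations\<close>

lemma claw_free_if_induced_free:
  assumes "induced_free (with_proj claw) G"
  shows "adj.claw_free (verts G)"
  unfolding adj.claw_free_def
proof (intro notI, elim bexE conjE)
  fix x a b c
  assume V: "x \<in> verts G" "a \<in> verts G" "b \<in> verts G" "c \<in> verts G"
    and E: "x \<rightarrow> a" "x \<rightarrow> b" "x \<rightarrow> c" and ne: "a \<noteq> b" "a \<noteq> c" "b \<noteq> c"
    and nE: "\<not> a \<rightarrow> b" "\<not> a \<rightarrow> c" "\<not> b \<rightarrow> c"
  have sym: "a \<rightarrow> x" "b \<rightarrow> x" "c \<rightarrow> x" "\<not> b \<rightarrow> a" "\<not> c \<rightarrow> a" "\<not> c \<rightarrow> b"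
    using E nE adj.adj_sym by blast+
  have "x \<noteq> a" "x \<noteq> b" "x \<noteq> c" using E adj.adj_irrefl by auto
  \<comment> \<open>The centre comes first because it is vertex 0 of \<open>claw\<close>.\<close>
  define f where "f i = [x, a, b, c] ! i" for i
  have f: "f 0 = x" "f 1 = a" "f 2 = b" "f 3 = c" by (simp_all add: f_def)
  have F: "pverts claw = {0, 1, 2, 3}"
    "parcs claw = {(0,1), (0,2), (0,3), (1,0), (2,0), (3,0)}"
    by (auto simp: claw_def symcl_def)
  have "\<forall>i\<in>pverts claw. \<forall>j\<in>pverts claw. (i, j) \<in> parcs claw \<longleftrightarrow> (f i) \<rightarrow> (f j)"
    by (simp add: F f E sym nE adj.adj_irrefl del: One_nat_def)
  moreover have "inj_on f (pverts claw)" "f ` pverts claw \<subseteq> verts G"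
    using ne \<open>x \<noteq> a\<close> \<open>x \<noteq> b\<close> \<open>x \<noteq> c\<close> V by (simp_all add: F f del: One_nat_def)
  moreover have "parcs claw \<subseteq> pverts claw \<times> pverts claw" by (simp add: F)
  ultimately have "\<not> induced_free (with_proj claw) G"
    by (intro pair_embedding_not_induced_free[OF nomulti_digraph, of _ f]) auto
  then show False using assms by simp
qed

lemma two_P3_free_if_induced_free:
  assumes "induced_free (with_proj two_P3) G"
  shows "adj.two_P3_free (verts G)"
  unfolding adj.two_P3_free_def
proof (intro notI, elim exE conjE)
  fix a b c a' b' c'
  assume V: "{a, b, c, a', b', c'} \<subseteq> verts G"
    and E: "a \<rightarrow> b" "b \<rightarrow> c" "a' \<rightarrow> b'" "b' \<rightarrow> c'" and ne: "a \<noteq> c" "a' \<noteq> c'"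
    and nE: "\<not> a \<rightarrow> c" "\<not> a' \<rightarrow> c'"
    and apart: "\<forall>u\<in>{a, b, c}. \<forall>v\<in>{a', b', c'}. u \<noteq> v \<and> \<not> u \<rightarrow> v"
  have sym: "b \<rightarrow> a" "c \<rightarrow> b" "b' \<rightarrow> a'" "c' \<rightarrow> b'" "\<not> c \<rightarrow> a" "\<not> c' \<rightarrow> a'"
    using E nE adj.adj_sym by blast+
  \<comment> \<open>Nonadjacency is needed in both directions, since \<open>two_P3\<close> is
    compared arc by arc.\<close>
  have apart': "\<forall>u\<in>{a, b, c}. \<forall>v\<in>{a', b', c'}. \<not> v \<rightarrow> u"
    using apart adj.adj_sym by meson
  note apart = apart[simplified] and apart' = apart'[simplified]
  have ne': "a \<noteq> b" "b \<noteq> c" "a' \<noteq> b'" "b' \<noteq> c'" using E adj.adj_irrefl by auto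
  define f where "f i = [a, b, c, a', b', c'] ! i" for i
  have f: "f 0 = a" "f 1 = b" "f 2 = c" "f 3 = a'" "f 4 = b'" "f 5 = c'" by (simp_all add: f_def)
  have F: "pverts two_P3 = {0, 1, 2, 3, 4, 5}"
    "parcs two_P3 = {(0,1), (1,2), (3,4), (4,5), (1,0), (2,1), (4,3), (5,4)}"
    by (auto simp: two_P3_def symcl_def)
  have "\<forall>i\<in>pverts two_P3. \<forall>j\<in>pverts two_P3. (i, j) \<in> parcs two_P3 \<longleftrightarrow> (f i) \<rightarrow> (f j)"
    by (simp add: F f E sym nE apart apart' adj.adj_irrefl del: One_nat_def)
  moreover have "inj_on f (pverts two_P3)" "f ` pverts two_P3 \<subseteq> verts G"
    using ne ne' apart V by (simp_all add: F f del: One_nat_def)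
  moreover have "parcs two_P3 \<subseteq> pverts two_P3 \<times> pverts two_P3" by (simp add: F)
  ultimately have "\<not> induced_free (with_proj two_P3) G"
    by (intro pair_embedding_not_induced_free[OF nomulti_digraph, of _ f]) auto
  then show False using assms by simp
qed

end

theorem theorem4:
  fixes G :: "('a,'b) pre_digraph" and F :: "nat pair_pre_digraph"
  assumes "F = two_P3 \<or> F = claw"
    and "graph G"
    and "induced_free (with_proj F) G"
    and "minimally_nonperfectly_divisible G"
  shows "\<not> (\<exists>X. clique_cutset G X)"
proof
  interpret graph G by fact
  have crit: "adj.critical (verts G)"
    using assms(4) by (rule minimally_nonperfectly_divisible_critical)
  assume "\<exists>X. clique_cutset G X"
  then obtain X where X: "clique_cutset G X" by blast
  then have linked: "adj.linked (verts G)"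
    using linked_if_connected by (simp add: clique_cutset_def)
  obtain V1 V2 where sep: "adj.separation (verts G) X V1 V2"
    using clique_cutset_separation[OF X] .
  have "\<not> adj.critical (verts G)"
    using assms(1)
  proof
    assume "F = two_P3"
    then have "adj.two_P3_free (verts G)" using assms(3) two_P3_free_if_induced_free by simp
    then show ?thesis using adj.two_P3_free_not_critical sep by simp
  next
    assume "F = claw"
    then have "adj.claw_free (verts G)" using assms(3) claw_free_if_induced_free by simp
    then show ?thesis using adj.claw_free_not_critical[OF _ _ linked sep] by simp
  qed
  then show False using crit by contradiction
qed

end
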